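(* Let $G$ be a graph and let $\mathcal{F} = \{F_v \colon v \in V_G\}$ be a family of nonempty graphs indexed by the vertices of $G$. Then the following hold: (1) $\gamma(G \circ \mathcal{F}) = |V_G|$. (2) $\gamma_{\rm a}(G \circ \mathcal{F}) = \gamma(G \circ \mathcal{F})$ if and only if $\gamma(F_v) > 1$ for some vertex $v$ of $G$. (3) $|V_G| \le \gamma_{\rm a}(G \circ \mathcal{F}) \le |V_G| + \min\{|V_{F_v}| \colon v \in V_G\}$.
   Context: Graphs are finite, simple, undirected, with nonempty vertex set; $V_G$ is the vertex set of $G$ and $N_G(v)$ is the open neighborhood of $v$. "Nonempty graph" means a graph with at least one vertex (for example $K_1$ is allowed). A dominating set of $G$ is a set $D \subseteq V_G$ such that every vertex of $V_G \setminus D$ is adjacent to at least one vertex of $D$. The domination number $\gamma(G)$ is the minimum cardinality of a dominating set of $G$. An accurate dominating set of $G$ is a dominating set $D$ of $G$ such that no $|D|$-element subset of $V_G \setminus D$ is a dominating set of $G$; the accurate domination number $\gamma_{\rm a}(G)$ is the minimum cardinality of an accurate dominating set of $G$. The $\mathcal{F}$-corona $G \circ \mathcal{F}$ is the graph with vertex set $(V_G \times \{0\}) \cup \bigcup_{v \in V_G} (\{v\} \times V_{F_v})$ (a disjoint union of a copy of $G$ and a copy of each $F_v$) and with open neighborhoods $N_{G\circ\mathcal{F}}((v,0)) = (N_G(v) \times \{0\}) \cup (\{v\} \times V_{F_v})$ for $v \in V_G$, and $N_{G \circ \mathcal{F}}((v,x)) = \{(v,0)\} \cup (\{v\} \times N_{F_v}(x))$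 for $v \in V_G$, $x \in V_{F_v}$. That is, $G\circ\mathcal{F}$ is obtained from disjoint copies of $G$ and of all the graphs $F_v$ by joining each vertex $v$ of $G$ to every vertex in the copy of $F_v$. *)

theory Defs
  imports "Graph_Theory.Pair_Digraph"
begin

text \<open>
  Simple undirected graphs are the \<^locale>\<open>pair_graph\<close>s: finite, loop-free, with a symmetric
  set of arcs, so that an edge between \<open>u\<close> and \<open>v\<close> is the pair of arcs \<open>(u, v)\<close> and \<open>(v, u)\<close>.
\<close>

definition nbhd :: "'a pair_pre_digraph \<Rightarrow> 'a \<Rightarrow> 'a set" where
  "nbhd G v = {u. (v, u) \<in> parcs G}"

definition dominating_set :: "'a pair_pre_digraph \<Rightarrow> 'a set \<Rightarrow> bool" where
  "dominating_set G D \<longleftrightarrow> D \<subseteq> pverts G \<and> (\<forall>v \<in> pverts G - D. \<exists>u \<in> D. u \<in> nbhd G v)"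

definition domination_number :: "'a pair_pre_digraph \<Rightarrow> nat" where
  "domination_number G = Min (card ` {D. dominating_set G D})"

definition accurate_dominating_set :: "'a pair_pre_digraph \<Rightarrow> 'a set \<Rightarrow> bool" where
  "accurate_dominating_set G D \<longleftrightarrow> dominating_set G D \<and>
     \<not> (\<exists>D'. D' \<subseteq> pverts G - D \<and> card D' = card D \<and> dominating_set G D')"

definition accurate_domination_number :: "'a pair_pre_digraph \<Rightarrow> nat" where
  "accurate_domination_number G = Min (card ` {D. accurate_dominating_set G D})"

text \<open>
  The vertex \<open>v\<close> of the copy of \<open>G\<close> is \<open>(v, None)\<close>, the vertex \<open>x\<close> of the copy of \<open>F v\<close> is
  \<open>(v, Some x)\<close>; the option type keeps the copies disjoint whatever the vertices of \<open>F v\<close> are.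
\<close>

definition corona ::
  "'a pair_pre_digraph \<Rightarrow> ('a \<Rightarrow> 'b pair_pre_digraph) \<Rightarrow> ('a \<times> 'b option) pair_pre_digraph" where
  "corona G F =
    \<lparr> pverts = (pverts G \<times> {None}) \<union> (\<Union>v \<in> pverts G. {v} \<times> Some ` pverts (F v)),
      parcs =
        {((u, None), (v, None)) | u v. (u, v) \<in> parcs G} \<union>
        {((v, Some x), (v, Some y)) | v x y. v \<in> pverts G \<and> (x, y) \<in> parcs (F v)} \<union>
        {((v, None), (v, Some x)) | v x. v \<in> pverts G \<and> x \<in> pverts (F v)} \<union>
        {((v, Some x), (v, None)) | v x. v \<in> pverts G \<and> x \<in> pverts (F v)} \<rparr>"

lemma nbhd_corona_None:
  assumes "v \<in> pverts G"
  shows "nbhd (corona G F) (v, None) = (nbhd G v \<times> {None}) \<union> ({v} \<times> Some ` pverts (F v))"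
  using assms by (auto simp: nbhd_def corona_def)

lemma nbhd_corona_Some:
  assumes "v \<in> pverts G" "x \<in> pverts (F v)"
  shows "nbhd (corona G F) (v, Some x) = {(v, None)} \<union> ({v} \<times> Some ` nbhd (F v) x)"
  using assms by (auto simp: nbhd_def corona_def)

lemma pair_graphI:
  assumes "finite (pverts G)"
    and "\<And>u v. (u, v) \<in> parcs G \<Longrightarrow> u \<in> pverts G \<and> v \<in> pverts G \<and> u \<noteq> v \<and> (v, u) \<in> parcs G"
  shows "pair_graph G"
proof -
  have "parcs G \<subseteq> pverts G \<times> pverts G"
    using assms(2) by auto
  then have "finite (parcs G)"
    using assms(1) by (meson finite_SigmaI finite_subset)
  then show ?thesis
    using assms by unfold_locales (auto simp: symmetric_def sym_def)
qed

lemma pair_graph_parcsD: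
  assumes "pair_graph G" "(u, v) \<in> parcs G"
  shows "u \<in> pverts G" "v \<in> pverts G" "u \<noteq> v" "(v, u) \<in> parcs G"
proof -
  interpret pair_graph G by fact
  show "u \<in> pverts G" "v \<in> pverts G"
    using assms(2) in_arcsD1 in_arcsD2 by auto
  show "u \<noteq> v" using assms(2) pair_no_loops by fastforce
  show "(v, u) \<in> parcs G"
    using pair_sym_arcs assms(2) by (auto simp: symmetric_def sym_def)
qed

lemma pair_graph_finite: "pair_graph G \<Longrightarrow> finite (pverts G)"
  by (simp add: pair_graph_def pair_digraph_def pair_fin_digraph_def pair_fin_digraph_axioms_def)

lemma pair_graph_corona:
  assumes "pair_graph G" "\<And>v. v \<in> pverts G \<Longrightarrow> pair_graph (F v)"
  shows "pair_graph (corona G F)"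
proof (rule pair_graphI)
  show "finite (pverts (corona G F))"
    using assms by (auto simp: corona_def pair_graph_finite)
next
  have G: "u \<in> pverts G" "v \<in> pverts G" "(v, u) \<in> parcs G" if "(u, v) \<in> parcs G" for u v
    using pair_graph_parcsD[OF assms(1) that] by simp_all
  have G': "(u, u) \<notin> parcs G" for u
    using pair_graph_parcsD(3)[OF assms(1)] by blast
  have F: "Some x \<in> Some ` pverts (F v)" "Some y \<in> Some ` pverts (F v)" "(y, x) \<in> parcs (F v)"
    if "v \<in> pverts G" "(x, y) \<in> parcs (F v)" for v x y
    using pair_graph_parcsD[OF assms(2)[OF that(1)] that(2)] by simp_all
  have F': "(x, x) \<notin> parcs (F v)" if "v \<in> pverts G" for v x
    using pair_graph_parcsD(3)[OF assms(2)[OF that]] by blast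
  fix p q assume "(p, q) \<in> parcs (corona G F)"
  then show "p \<in> pverts (corona G F) \<and> q \<in> pverts (corona G F) \<and> p \<noteq> q \<and>
      (q, p) \<in> parcs (corona G F)"
    by (auto simp: corona_def G' F' intro: G F)
qed

text \<open>Both minima range over finite nonempty sets.\<close>

lemma finite_dominating_sets:
  assumes "finite (pverts G)"
  shows "finite {D. dominating_set G D}" "finite {D. accurate_dominating_set G D}"
  by (rule finite_subset[of _ "Pow (pverts G)"],
      auto simp: assms dominating_set_def accurate_dominating_set_def)+

lemma accurate_dominating_set_pverts:
  assumes "finite (pverts G)" "pverts G \<noteq> {}"
  shows "dominating_set G (pverts G)" "accurate_dominating_set G (pverts G)"
  using assms by (auto simp: dominating_set_def accurate_dominating_set_def)

end

theory Submission
  imports Defs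
begin

text \<open>
  A set of vertices dominates the corona iff, over each vertex \<open>v\<close> of \<open>G\<close>, it contains \<open>v\<close> itself or
  restricts to a dominating set of \<open>F v\<close>. Hence it meets every fibre, and a dominating set with
  \<open>card (pverts G)\<close> elements meets each fibre exactly once. If every \<open>F v\<close> has a universal vertex,
  such a set is never accurate, since in each fibre one can swap \<open>v\<close> and the universal vertex.
  If some \<open>F v\<close> has none, the copy of \<open>G\<close> is accurate. The copy of \<open>G\<close> together with a whole copy
  of \<open>F v\<close> is always accurate, since its complement misses the fibre over \<open>v\<close>.
\<close>

section \<open>Both domination numbers as attained minima\<close>

lemma domination_number_le:
  assumes "finite (pverts G)" "dominating_set G D"
  shows "domination_number G \<le> card D"
  using assms finite_dominating_sets(1)[OF assms(1)]
  by (auto simp: domination_number_def intro: Min_le)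

lemma domination_number_attained:
  assumes "finite (pverts G)"
  obtains D where "dominating_set G D" "card D = domination_number G"
proof -
  have "domination_number G \<in> card ` {D. dominating_set G D}"
    unfolding domination_number_def
  proof (rule Min_in)
    show "finite (card ` {D. dominating_set G D})"
      using finite_dominating_sets(1)[OF assms] by simp
    have "dominating_set G (pverts G)" by (simp add: dominating_set_def)
    then show "card ` {D. dominating_set G D} \<noteq> {}" by blast
  qed
  then show ?thesis using that by auto
qed

lemma accurate_domination_number_le:
  assumes "finite (pverts G)" "accurate_dominating_set G D"
  shows "accurate_domination_number G \<le> card D"
  using assms finite_dominating_sets(2)[OF assms(1)]
  by (auto simp: accurate_domination_number_def intro: Min_le)

text \<open>Nonemptiness matters: on the empty graph the empty set competes with itself, so no
  accurate dominating set exists. Otherwise the whole vertex set is accurate, because only the empty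
  set avoids it.\<close>

lemma accurate_domination_number_attained:
  assumes "finite (pverts G)" "pverts G \<noteq> {}"
  obtains D where "accurate_dominating_set G D" "card D = accurate_domination_number G"
proof -
  have "accurate_domination_number G \<in> card ` {D. accurate_dominating_set G D}"
    unfolding accurate_domination_number_def
    by (rule Min_in) (use finite_dominating_sets(2)[OF assms(1)]
        accurate_dominating_set_pverts(2)[OF assms] in auto)
  then show ?thesis using that by auto
qed

lemma domination_number_le_accurate:
  assumes "finite (pverts G)" "pverts G \<noteq> {}"
  shows "domination_number G \<le> accurate_domination_number G"
  using accurate_domination_number_attained[OF assms] domination_number_le[OF assms(1)]
  by (metis accurate_dominating_set_def)

lemma dominating_set_nonempty:
  assumes "dominating_set G D" "pverts G \<noteq> {}"
  shows "D \<noteq> {}"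
  using assms by (auto simp: dominating_set_def)

text \<open>Translates the numerical condition on \<open>F v\<close> into the existence of a
  universal vertex. The value 0 is excluded because a nonempty graph is not dominated by the empty
  set.\<close>

lemma dominating_vertex_iff_domination_number_le_1:
  assumes "finite (pverts G)" "pverts G \<noteq> {}"
  shows "(\<exists>x. dominating_set G {x}) \<longleftrightarrow> domination_number G \<le> 1"
proof
  assume "\<exists>x. dominating_set G {x}"
  then show "domination_number G \<le> 1"
    using domination_number_le[OF assms(1)] by fastforce
next
  assume le: "domination_number G \<le> 1"
  obtain D where D: "dominating_set G D" "card D = domination_number G"
    using domination_number_attained[OF assms(1)] .
  have "D \<noteq> {}" "finite D"
    using dominating_set_nonempty[OF D(1) assms(2)] D(1) assms(1)
    by (auto simp: dominating_set_def intro: finite_subset)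
  then have "card D = 1"
    using le D(2) by (metis card_0_eq le_neq_implies_less less_one)
  then show "\<exists>x. dominating_set G {x}"
    using D(1) by (auto simp: card_1_singleton_iff)
qed

section \<open>Dominating sets of the corona, fibre by fibre\<close>

locale graph_corona =
  fixes G :: "'a pair_pre_digraph" and F :: "'a \<Rightarrow> 'b pair_pre_digraph"
  assumes graph: "pair_graph G" and nonempty: "pverts G \<noteq> {}"
    and family_graph: "\<And>v. v \<in> pverts G \<Longrightarrow> pair_graph (F v)"
    and family_nonempty: "\<And>v. v \<in> pverts G \<Longrightarrow> pverts (F v) \<noteq> {}"
begin

lemma finite_family: "v \<in> pverts G \<Longrightarrow> finite (pverts (F v))"
  by (simp add: family_graph pair_graph_finite)

lemma finite_corona: "finite (pverts (corona G F))"
  using pair_graph_corona[OF graph family_graph] by (rule pair_graph_finite)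

lemma corona_nonempty: "pverts (corona G F) \<noteq> {}"
  using nonempty by (auto simp: corona_def)

text \<open>All neighbours of \<open>(v, Some x)\<close> lie in the fibre over \<open>v\<close>, so
  each copy of \<open>F v\<close> must be dominated from within its own fibre. The vertices
  \<open>(v, None)\<close> add no condition: if one is not in \<open>D\<close>, the part of
  \<open>D\<close> in the copy of \<open>F v\<close> dominates a nonempty graph, so it has an
  element, and this element is adjacent to \<open>(v, None)\<close>.\<close>

lemma dominating_set_corona_iff:
  "dominating_set (corona G F) D \<longleftrightarrow> D \<subseteq> pverts (corona G F) \<and>
     (\<forall>v \<in> pverts G. (v, None) \<in> D \<or> dominating_set (F v) {x. (v, Some x) \<in> D})"
  (is "?L \<longleftrightarrow> ?R")
proof
  assume dom: ?L
  have sub: "D \<subseteq> pverts (corona G F)" using dom by (simp add: dominating_set_def)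
  have "dominating_set (F v) {x. (v, Some x) \<in> D}" if v: "v \<in> pverts G" "(v, None) \<notin> D" for v
    unfolding dominating_set_def
  proof (intro conjI ballI)
    show "{x. (v, Some x) \<in> D} \<subseteq> pverts (F v)"
      using sub by (auto simp: corona_def)
  next
    fix x assume x: "x \<in> pverts (F v) - {x. (v, Some x) \<in> D}"
    then have "(v, Some x) \<in> pverts (corona G F) - D"
      using v by (auto simp: corona_def)
    then obtain p where "p \<in> D" "p \<in> nbhd (corona G F) (v, Some x)"
      using dom unfolding dominating_set_def by blast
    then show "\<exists>y \<in> {x. (v, Some x) \<in> D}. y \<in> nbhd (F v) x"
      using v x by (auto simp: nbhd_corona_Some)
  qed
  then show ?R using sub by blast
next
  assume R: ?R
  show ?L
    unfolding dominating_set_def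
  proof (intro conjI ballI)
    show "D \<subseteq> pverts (corona G F)" using R by blast
  next
    fix p assume p: "p \<in> pverts (corona G F) - D"
    then consider v where "p = (v, None)" "v \<in> pverts G"
      | v x where "p = (v, Some x)" "v \<in> pverts G" "x \<in> pverts (F v)"
      by (auto simp: corona_def)
    then show "\<exists>q \<in> D. q \<in> nbhd (corona G F) p"
    proof cases
      case 1
      then have dom: "dominating_set (F v) {x. (v, Some x) \<in> D}" using R p by auto
      then obtain x where "(v, Some x) \<in> D"
        using dominating_set_nonempty[OF _ family_nonempty] 1(2) by blast
      moreover have "x \<in> pverts (F v)"
        using dom \<open>(v, Some x) \<in> D\<close> by (auto simp: dominating_set_def)
      ultimately show ?thesis
        using 1 by (auto simp: nbhd_corona_None intro!: bexI[of _ "(v, Some x)"])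
    next
      case 2
      show ?thesis
      proof (cases "(v, None) \<in> D")
        case True
        then show ?thesis using 2 by (auto simp: nbhd_corona_Some)
      next
        case False
        then have "dominating_set (F v) {x. (v, Some x) \<in> D}" using R 2 by auto
        then obtain y where "(v, Some y) \<in> D" "y \<in> nbhd (F v) x"
          using 2 p by (auto simp: dominating_set_def)
        then show ?thesis
          using 2 by (auto simp: nbhd_corona_Some intro!: bexI[of _ "(v, Some y)"])
      qed
    qed
  qed
qed

lemma fst_image_dominating_set:
  assumes "dominating_set (corona G F) D"
  shows "fst ` D = pverts G"
proof
  show "fst ` D \<subseteq> pverts G"
    using assms by (auto simp: dominating_set_def corona_def)
  show "pverts G \<subseteq> fst ` D"
  proof
    fix v assume v: "v \<in> pverts G"
    then consider "(v, None) \<in> D" | "dominating_set (F v) {x. (v, Some x) \<in> D}"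
      using assms dominating_set_corona_iff by blast
    then show "v \<in> fst ` D"
      using dominating_set_nonempty[OF _ family_nonempty[OF v]] by cases force+
  qed
qed

lemma finite_dominating_set: "dominating_set (corona G F) D \<Longrightarrow> finite D"
  using finite_corona by (auto simp: dominating_set_def intro: finite_subset)

lemma card_dominating_set_ge:
  assumes "dominating_set (corona G F) D"
  shows "card (pverts G) \<le> card D"
  using card_image_le[OF finite_dominating_set[OF assms], of fst]
  by (simp add: fst_image_dominating_set[OF assms])

text \<open>\<open>fst\<close> maps the finite set \<open>D\<close> onto a set of the same
  cardinality, so \<open>D\<close> has exactly one vertex in each fibre.\<close>

lemma inj_on_fst_minimum_dominating_set:
  assumes "dominating_set (corona G F) D" "card D = card (pverts G)"
  shows "inj_on fst D"
  by (rule eq_card_imp_inj_on)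
     (simp_all add: assms finite_dominating_set fst_image_dominating_set)

section \<open>Domination and accurate domination numbers of the corona\<close>

abbreviation base :: "('a \<times> 'b option) set" where
  "base \<equiv> pverts G \<times> {None}"

lemma dominating_set_base: "dominating_set (corona G F) base"
  by (auto simp: dominating_set_corona_iff) (auto simp: corona_def)

lemma card_base: "card base = card (pverts G)"
  by (simp add: card_cartesian_product)

lemma domination_number_corona: "domination_number (corona G F) = card (pverts G)"
proof (rule antisym)
  show "domination_number (corona G F) \<le> card (pverts G)"
    using domination_number_le[OF finite_corona dominating_set_base] by (simp add: card_base)
  show "card (pverts G) \<le> domination_number (corona G F)"
    using domination_number_attained[OF finite_corona] card_dominating_set_ge by metis
qed

text \<open>A competitor of the same size avoids \<open>(v, None)\<close> and has a single vertex
  over \<open>v\<close>; that vertex alone would have to dominate \<open>F v\<close>.\<close>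

lemma accurate_dominating_set_base:
  assumes v: "v \<in> pverts G" "domination_number (F v) > 1"
  shows "accurate_dominating_set (corona G F) base"
  unfolding accurate_dominating_set_def
proof (intro conjI notI)
  show "dominating_set (corona G F) base" by (rule dominating_set_base)
  assume "\<exists>D. D \<subseteq> pverts (corona G F) - base \<and> card D = card base \<and>
    dominating_set (corona G F) D"
  then obtain D where D: "D \<inter> base = {}" "card D = card (pverts G)"
      "dominating_set (corona G F) D"
    by (auto simp: card_base)
  have inj: "inj_on fst D" by (rule inj_on_fst_minimum_dominating_set) (use D in auto)
  have dom: "dominating_set (F v) {x. (v, Some x) \<in> D}"
    using D v(1) by (auto simp: dominating_set_corona_iff)
  then obtain x where x: "(v, Some x) \<in> D"
    using dominating_set_nonempty[OF _ family_nonempty[OF v(1)]] by blast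
  \<comment> \<open>Two elements of \<open>D\<close> over \<open>v\<close> share their first
    component, so injectivity of \<open>fst\<close> identifies them.\<close>
  have "{x. (v, Some x) \<in> D} = {x}"
    using x inj_onD[OF inj _ _ x] by fastforce
  then show False
    using dom v(2)
      dominating_vertex_iff_domination_number_le_1[OF finite_family family_nonempty, OF v(1) v(1)]
    by auto
qed

lemma not_accurate_minimum_dominating_set:
  assumes le: "\<And>v. v \<in> pverts G \<Longrightarrow> domination_number (F v) \<le> 1"
    and D: "dominating_set (corona G F) D" "card D = card (pverts G)"
  shows "\<not> accurate_dominating_set (corona G F) D"
proof -
  have "\<forall>v \<in> pverts G. \<exists>x. dominating_set (F v) {x}"
    using dominating_vertex_iff_domination_number_le_1[OF finite_family family_nonempty] le
    by blast
  then obtain c where c: "\<And>v. v \<in> pverts G \<Longrightarrow> dominating_set (F v) {c v}" by metis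
  \<comment> \<open>In each fibre \<open>swap\<close> picks a vertex that \<open>D\<close> leaves
    free: the universal vertex of \<open>F v\<close> if \<open>D\<close> uses
    \<open>(v, None)\<close>, and \<open>(v, None)\<close> otherwise. Either choice dominates the
    copy of \<open>F v\<close>.\<close>
  define swap where "swap v = (v, if (v, None) \<in> D then Some (c v) else None)" for v
  let ?D = "swap ` pverts G"
  have inj: "inj_on fst D" by (rule inj_on_fst_minimum_dominating_set[OF D])
  \<comment> \<open>Injectivity of \<open>fst\<close> on \<open>D\<close> is what keeps
    \<open>(v, Some (c v))\<close> out of \<open>D\<close> once \<open>(v, None)\<close> is in
    it.\<close>
  have "swap v \<in> pverts (corona G F) - D" if "v \<in> pverts G" for v
    using that c[OF that] inj_onD[OF inj, of "(v, None)" "(v, Some (c v))"]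
    by (auto simp: swap_def corona_def dominating_set_def)
  then have sub: "?D \<subseteq> pverts (corona G F) - D" by blast
  have "{x. (v, Some x) \<in> ?D} = {c v}" if "v \<in> pverts G" "(v, None) \<in> D" for v
    using that by (auto simp: swap_def image_iff split: if_splits)
  moreover have "(v, None) \<in> ?D" if "v \<in> pverts G" "(v, None) \<notin> D" for v
    using that by (auto simp: swap_def image_iff)
  ultimately have "dominating_set (corona G F) ?D"
    using sub c by (subst dominating_set_corona_iff) (metis Diff_subset subset_trans)
  moreover have "card ?D = card D"
    using D(2) by (simp add: card_image inj_on_def swap_def)
  ultimately show ?thesis
    using sub by (auto simp: accurate_dominating_set_def)
qed

text \<open>Under equality, an optimal accurate set is a dominating set with
  \<open>card (pverts G)\<close> elements, which the swap forbids when every \<open>F v\<close> has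
  a universal vertex. Conversely, \<open>base\<close> attains the lower bound.\<close>

lemma accurate_domination_number_corona_eq_iff:
  "accurate_domination_number (corona G F) = domination_number (corona G F) \<longleftrightarrow>
     (\<exists>v \<in> pverts G. domination_number (F v) > 1)"
proof
  assume eq: "accurate_domination_number (corona G F) = domination_number (corona G F)"
  obtain D where D: "accurate_dominating_set (corona G F) D"
      "card D = accurate_domination_number (corona G F)"
    using accurate_domination_number_attained[OF finite_corona corona_nonempty] .
  then have "dominating_set (corona G F) D" "card D = card (pverts G)"
    using eq by (auto simp: accurate_dominating_set_def domination_number_corona)
  then show "\<exists>v \<in> pverts G. domination_number (F v) > 1"
    using not_accurate_minimum_dominating_set D(1) not_le by blast
next
  assume "\<exists>v \<in> pverts G. domination_number (F v) > 1"
  then have "accurate_domination_number (corona G F) \<le> card base"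
    using accurate_domination_number_le[OF finite_corona] accurate_dominating_set_base by blast
  then show "accurate_domination_number (corona G F) = domination_number (corona G F)"
    using domination_number_le_accurate[OF finite_corona corona_nonempty]
    by (simp add: card_base domination_number_corona)
qed

text \<open>Adding the whole fibre over one \<open>v\<close> to \<open>base\<close> leaves every
  disjoint set without a vertex over \<open>v\<close>; such a set cannot dominate, whatever its
  size.\<close>

lemma accurate_domination_number_corona_le:
  assumes v: "v \<in> pverts G"
  shows "accurate_domination_number (corona G F) \<le> card (pverts G) + card (pverts (F v))"
proof -
  let ?D = "base \<union> {v} \<times> Some ` pverts (F v)"
  have "dominating_set (corona G F) ?D"
    using v by (auto simp: dominating_set_corona_iff) (auto simp: corona_def)
  moreover have "v \<notin> fst ` D" if "D \<subseteq> pverts (corona G F) - ?D" for D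
    using that by (auto simp: corona_def)
  ultimately have "accurate_dominating_set (corona G F) ?D"
    using v fst_image_dominating_set by (metis accurate_dominating_set_def)
  then have "accurate_domination_number (corona G F) \<le> card ?D"
    by (rule accurate_domination_number_le[OF finite_corona])
  also have "\<dots> \<le> card base + card ({v} \<times> Some ` pverts (F v))"
    by (rule card_Un_le)
  also have "\<dots> = card (pverts G) + card (pverts (F v))"
    by (simp add: card_cartesian_product card_image)
  finally show ?thesis .
qed

end

theorem theorem2:
  fixes G :: "'a pair_pre_digraph"
    and F :: "'a \<Rightarrow> 'b pair_pre_digraph"
  assumes "pair_graph G" and "pverts G \<noteq> {}"
    and "\<And>v. v \<in> pverts G \<Longrightarrow> pair_graph (F v)"
    and "\<And>v. v \<in> pverts G \<Longrightarrow> pverts (F v) \<noteq> {}"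
  shows "domination_number (corona G F) = card (pverts G) \<and>
    (accurate_domination_number (corona G F) = domination_number (corona G F)
       \<longleftrightarrow> (\<exists>v \<in> pverts G. domination_number (F v) > 1)) \<and>
    card (pverts G) \<le> accurate_domination_number (corona G F) \<and>
    accurate_domination_number (corona G F)
      \<le> card (pverts G) + Min {card (pverts (F v)) | v. v \<in> pverts G}"
proof -
  interpret graph_corona G F by (rule graph_corona.intro) (fact assms)+
  let ?sizes = "{card (pverts (F v)) | v. v \<in> pverts G}"
  \<comment> \<open>The upper bound holds for each single \<open>v\<close>, so it is applied at a
    vertex where the order of \<open>F v\<close> is smallest.\<close>
  have "Min ?sizes \<in> ?sizes"
    by (rule Min_in) (use assms(2) pair_graph_finite[OF assms(1)] in auto)
  then obtain v where "v \<in> pverts G" "Min ?sizes = card (pverts (F v))" by blast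
  then have "accurate_domination_number (corona G F) \<le> card (pverts G) + Min ?sizes"
    using accurate_domination_number_corona_le by simp
  moreover have "card (pverts G) \<le> accurate_domination_number (corona G F)"
    using domination_number_le_accurate[OF finite_corona corona_nonempty]
    by (simp add: domination_number_corona)
  ultimately show ?thesis
    using domination_number_corona accurate_domination_number_corona_eq_iff by blast
qed

end
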